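(* Let $\mathbf{A}=[\underline{A},\overline{A}]$ be an $n\times n$ real interval matrix such that every $A\in\mathbf{A}$ is an M-matrix. Then $\det(\mathbf{A})=[\det(\underline{A}),\det(\overline{A})]$.
   Context: Inequalities between matrices are entrywise. For $\underline{A}\le\overline{A}$ in $\mathbb{R}^{n\times n}$, the interval matrix is $\mathbf{A}=\{A\in\mathbb{R}^{n\times n} : \underline{A}\le A\le\overline{A}\}$. A matrix $A\in\mathbb{R}^{n\times n}$ is an M-matrix if $a_{ij}\le 0$ for all $i\ne j$, $A$ is nonsingular, and $A^{-1}\ge 0$. The range of the determinant is $\det(\mathbf{A})=\{\det(A) : A\in\mathbf{A}\}$. *)

theory Defs
  imports "HOL-Analysis.Analysis"
begin

text \<open>
  The order on \<open>real ^ 'n ^ 'n\<close> is the library's componentwise vector order, so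
  \<open>A \<le> B\<close> is the entrywise inequality of matrices (the entry in row \<open>i\<close> and column \<open>j\<close>
  being \<open>A $ i $ j\<close>).
\<close>

definition interval_matrix :: "real ^ 'n ^ 'n \<Rightarrow> real ^ 'n ^ 'n \<Rightarrow> (real ^ 'n ^ 'n) set"
  where "interval_matrix L U = {A. L \<le> A \<and> A \<le> U}"

text \<open>
  \<open>matrix_inv A\<close> is the inverse of \<open>A\<close> only for invertible \<open>A\<close>; nonsingularity is therefore
  an explicit conjunct.
\<close>

definition M_matrix :: "real ^ 'n ^ 'n \<Rightarrow> bool"
  where "M_matrix A \<longleftrightarrow>
    (\<forall>i j. i \<noteq> j \<longrightarrow> A $ i $ j \<le> 0) \<and> invertible A \<and> 0 \<le> matrix_inv A"

lemma matrix_le_iff: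
  fixes A B :: "real ^ 'n ^ 'n"
  shows "A \<le> B \<longleftrightarrow> (\<forall>i j. A $ i $ j \<le> B $ i $ j)"
  by (simp add: less_eq_vec_def)

end

theory Submission
  imports Defs
begin

text \<open>
  A matrix with nonpositive off-diagonal entries that maps some positive vector to a positive vector
  is nonsingular, and so is every matrix on its segment to the identity; hence its determinant is
  positive. An M-matrix \<open>A\<close> maps \<open>A\<^sup>-\<^sup>1 1 > 0\<close> to \<open>1\<close>, so its determinant is positive.
  Increasing a single row of \<open>A\<close> by \<open>w \<ge> 0\<close> increases the determinant by
  \<open>(w A\<^sup>-\<^sup>1)\<^sub>i det A \<ge> 0\<close> (Cramer); replacing the rows one at a time shows that \<open>det\<close> is
  monotone on the interval, and the intermediate value theorem fills the gap.
\<close>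

lemma continuous_on_det [continuous_intros]:
  fixes f :: "'a::topological_space \<Rightarrow> real ^ 'n ^ 'n"
  assumes "continuous_on S f"
  shows "continuous_on S (\<lambda>x. det (f x))"
  unfolding det_def by (intro continuous_intros assms)

lemma matrix_inv_inverse:
  fixes A :: "'a::semiring_1 ^ 'n ^ 'm"
  assumes "invertible A"
  shows "A ** matrix_inv A = mat 1" and "matrix_inv A ** A = mat 1"
  using someI_ex[OF assms[unfolded invertible_def]] by (simp_all add: matrix_inv_def)

text \<open>Positivity of \<open>A *v v\<close> is strict diagonal dominance of the rows once the
  columns are weighted by \<open>v\<close>, so the classical maximal-entry argument shows that the
  kernel is trivial.\<close>

lemma invertible_if_Z_matrix_pos:
  fixes A :: "real ^ 'n ^ 'n"
  assumes Z: "\<And>i j. i \<noteq> j \<Longrightarrow> A $ i $ j \<le> 0"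
    and v: "\<And>i. 0 < v $ i"
    and Av: "\<And>i. 0 < (A *v v) $ i"
  shows "invertible A"
proof -
  have "x = 0" if Ax: "A *v x = 0" for x
  proof -
    \<comment> \<open>Sizes of the entries of \<open>x\<close> relative to \<open>v\<close>. In the
      row \<open>k\<close> with the largest ratio, all entries of \<open>x\<close> are bounded by
      \<open>r k\<close> times those of \<open>v\<close>, so \<open>r k > 0\<close> would contradict
      the dominance in that row.\<close>
    define r where "r i = \<bar>x $ i\<bar> / v $ i" for i
    obtain k where k: "\<And>j. r j \<le> r k"
      using obtains_MAX[of "UNIV :: 'n set" r] by (metis Max_ge UNIV_I UNIV_not_empty finite finite_imageI imageI)
    have xk: "\<bar>x $ j\<bar> \<le> r k * v $ j" for j
      using k[of j] v[of j] by (simp add: r_def[of j] divide_le_eq)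
    have eq: "A $ k $ k * x $ k = (\<Sum>j\<in>UNIV - {k}. - (A $ k $ j) * x $ j)"
      using arg_cong[OF Ax, of "\<lambda>y. y $ k"]
      by (simp add: matrix_vector_mult_def sum.remove[of UNIV k] sum_negf)
    have Avk: "(\<Sum>j\<in>UNIV - {k}. - (A $ k $ j) * v $ j) < A $ k $ k * v $ k"
      using Av[of k] by (simp add: matrix_vector_mult_def sum.remove[of UNIV k] sum_negf)
    have "0 \<le> (\<Sum>j\<in>UNIV - {k}. - (A $ k $ j) * v $ j)"
      using Z v by (intro sum_nonneg mult_nonneg_nonneg) (auto simp: less_imp_le)
    then have diag: "0 < A $ k $ k"
      using Avk v[of k] by (metis order.strict_trans1 zero_less_mult_pos2)
    have "A $ k $ k * \<bar>x $ k\<bar> = \<bar>A $ k $ k * x $ k\<bar>"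
      using diag by (simp add: abs_mult)
    also have "\<dots> \<le> (\<Sum>j\<in>UNIV - {k}. - (A $ k $ j) * \<bar>x $ j\<bar>)"
      unfolding eq using Z
      by (intro order_trans[OF sum_abs] sum_mono) (auto simp: abs_mult)
    also have "\<dots> \<le> (\<Sum>j\<in>UNIV - {k}. - (A $ k $ j) * (r k * v $ j))"
      using Z xk by (intro sum_mono mult_left_mono) auto
    also have "\<dots> = r k * (\<Sum>j\<in>UNIV - {k}. - (A $ k $ j) * v $ j)"
      by (simp add: sum_distrib_left mult_ac)
    finally have le: "A $ k $ k * \<bar>x $ k\<bar> \<le> r k * (\<Sum>j\<in>UNIV - {k}. - (A $ k $ j) * v $ j)" .
    have "\<not> 0 < r k"
    proof
      assume "0 < r k"
      then have "r k * (\<Sum>j\<in>UNIV - {k}. - (A $ k $ j) * v $ j) < r k * (A $ k $ k * v $ k)"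
        using Avk by (rule mult_strict_left_mono[rotated])
      also have "r k * (A $ k $ k * v $ k) = A $ k $ k * \<bar>x $ k\<bar>"
        using v[of k] by (simp add: r_def)
      finally show False using le by simp
    qed
    then have "\<bar>x $ j\<bar> \<le> 0" for j
      using xk[of j] v[of j] by (meson mult_nonpos_nonneg less_imp_le not_less order_trans)
    then show "x = 0" by (simp add: vec_eq_iff)
  qed
  then show ?thesis
    by (simp add: invertible_left_inverse matrix_left_invertible_ker)
qed

lemma det_pos_if_Z_matrix_pos:
  fixes A :: "real ^ 'n ^ 'n"
  assumes Z: "\<And>i j. i \<noteq> j \<Longrightarrow> A $ i $ j \<le> 0"
    and v: "\<And>i. 0 < v $ i"
    and Av: "\<And>i. 0 < (A *v v) $ i"
  shows "0 < det A"
proof (rule ccontr)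
  define F where "F t = (1 - t) *\<^sub>R A + t *\<^sub>R mat 1" for t :: real
  assume "\<not> 0 < det A"
  then have "det (F 0) \<le> 0" "0 \<le> det (F 1)" by (simp_all add: F_def)
  moreover have "continuous_on {0..1} (\<lambda>t. det (F t))"
    unfolding F_def by (intro continuous_intros)
  ultimately obtain t where t: "0 \<le> t" "t \<le> 1" "det (F t) = 0"
    using IVT'[of "\<lambda>t. det (F t)" 0 0 1] by auto
  have "invertible (F t)"
  proof (rule invertible_if_Z_matrix_pos)
    show "F t $ i $ j \<le> 0" if "i \<noteq> j" for i j
      using Z[OF that] t that by (simp add: F_def mat_def mult_nonneg_nonpos)
    show "0 < v $ i" for i by (rule v)
    have "(F t *v v) = (1 - t) *\<^sub>R (A *v v) + t *\<^sub>R v"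
      by (simp add: F_def matrix_vector_mult_add_rdistrib scaleR_matrix_vector_assoc[symmetric])
    then show "0 < (F t *v v) $ i" for i
      \<comment> \<open>The same \<open>v\<close> serves the whole segment: at \<open>t = 0\<close>
        positivity comes from \<open>A *v v\<close>, for \<open>t > 0\<close> from the summand
        \<open>t *\<^sub>R v\<close>.\<close>
      using v[of i] Av[of i] t
      by (cases "t = 0") (auto intro!: add_nonneg_pos)
  qed
  with t show False by (simp add: invertible_det_nz)
qed

lemma M_matrix_det_pos:
  fixes A :: "real ^ 'n ^ 'n"
  assumes "M_matrix A"
  shows "0 < det A"
proof -
  have Z: "A $ i $ j \<le> 0" if "i \<noteq> j" for i j using assms that by (simp add: M_matrix_def)
  have inv: "A ** matrix_inv A = mat 1"
    using assms by (simp add: M_matrix_def matrix_inv_inverse)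
  have inv_ge: "0 \<le> matrix_inv A $ i $ j" for i j
    using assms by (simp add: M_matrix_def less_eq_vec_def)
  define v where "v = matrix_inv A *v 1"
  have Av: "A *v v = 1" by (simp add: v_def matrix_vector_mul_assoc inv)
  have v_ge: "0 \<le> v $ i" for i
    by (auto simp: v_def matrix_vector_mult_def intro!: sum_nonneg inv_ge)
  have "0 < v $ i" for i
  proof -
    \<comment> \<open>Off-diagonal terms cannot contribute positively to row \<open>i\<close> of
      \<open>A *v v = 1\<close>, so the diagonal term is nonzero.\<close>
    have "(\<Sum>j\<in>UNIV - {i}. A $ i $ j * v $ j) \<le> 0"
      using Z v_ge by (intro sum_nonpos mult_nonpos_nonneg) auto
    moreover have "A $ i $ i * v $ i + (\<Sum>j\<in>UNIV - {i}. A $ i $ j * v $ j) = 1"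
      using arg_cong[OF Av, of "\<lambda>y. y $ i"]
      by (simp add: matrix_vector_mult_def sum.remove[of UNIV i])
    ultimately have "v $ i \<noteq> 0" by auto
    with v_ge[of i] show ?thesis by simp
  qed
  then show ?thesis
    using det_pos_if_Z_matrix_pos[of A v] Z Av by simp
qed

lemma M_matrix_det_row_mono:
  fixes A B :: "real ^ 'n ^ 'n"
  assumes M: "M_matrix A"
    and eq: "\<And>i. i \<noteq> k \<Longrightarrow> B $ i = A $ i"
    and le: "A $ k \<le> B $ k"
  shows "det A \<le> det B"
proof -
  define w where "w = B $ k - A $ k"
  \<comment> \<open>The coordinates of \<open>w\<close> in the basis formed by the rows of
    \<open>A\<close>; they are nonnegative because \<open>w\<close> and the inverse are.\<close>
  define y where "y = w v* matrix_inv A"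
  have w: "0 \<le> w $ i" for i using le by (simp add: w_def less_eq_vec_def)
  have inv_ge: "0 \<le> matrix_inv A $ i $ j" for i j
    using M by (simp add: M_matrix_def less_eq_vec_def)
  have "matrix_inv A ** A = mat 1"
    using M by (simp add: M_matrix_def matrix_inv_inverse)
  then have "y v* A = w"
    by (simp add: y_def vector_matrix_mul_assoc)
  then have wsum: "w = (\<Sum>i\<in>UNIV. y $ i *s row i A)"
    by (auto simp: vec_eq_iff vector_matrix_mult_def row_def mult.commute)
  have "B = (\<chi> i. if i = k then row k A + w else row i A)"
    using eq by (auto simp: vec_eq_iff row_def w_def)
  then have "det B = det (\<chi> i. if i = k then row k A else row i A) + det (\<chi> i. if i = k then w else row i A)"
    using det_row_add[of k "\<lambda>_. row k A" "\<lambda>_. w" "\<lambda>i. row i A"] by simp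
  also have "(\<chi> i. if i = k then row k A else row i A) = A"
    by (auto simp: vec_eq_iff row_def)
  \<comment> \<open>Only the multiple of row \<open>k\<close> in \<open>w\<close> survives; the
    other summands repeat a row of \<open>A\<close>.\<close>
  also have "det (\<chi> i. if i = k then w else row i A) = y $ k * det A"
    unfolding wsum by (rule cramer_lemma_transpose)
  finally have "det B = det A + y $ k * det A" .
  moreover have "0 \<le> y $ k"
    by (auto simp: y_def vector_matrix_mult_def intro!: sum_nonneg mult_nonneg_nonneg w inv_ge)
  ultimately show ?thesis using M_matrix_det_pos[OF M] by simp
qed

lemma det_mono_interval_M_matrix:
  fixes A B :: "real ^ 'n ^ 'n"
  assumes "A \<le> B" and M: "\<forall>C \<in> interval_matrix A B. M_matrix C"
  shows "det A \<le> det B"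
proof -
  \<comment> \<open>Hybrids that take the rows in \<open>S\<close> from \<open>B\<close>. Each lies
    in the interval, hence is an M-matrix, so the one-row comparison applies at every stage.\<close>
  define H where "H S = (\<chi> i. if i \<in> S then B $ i else A $ i)" for S
  have row_le: "A $ i \<le> B $ i" for i using \<open>A \<le> B\<close> by (simp add: less_eq_vec_def)
  have H_mem: "H S \<in> interval_matrix A B" for S
    using row_le by (simp add: interval_matrix_def less_eq_vec_def[of A] less_eq_vec_def[of _ B] H_def)
  have "det A \<le> det (H S)" if "finite S" for S
    using that
  proof induction
    case empty
    have "H {} = A" by (simp add: H_def vec_eq_iff)
    then show ?case by simp
  next
    case (insert k S)
    have "det (H S) \<le> det (H (insert k S))"
      using M H_mem[of S] insert.hyps row_le
      by (intro M_matrix_det_row_mono[of _ k]) (auto simp: H_def)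
    with insert.IH show ?case by simp
  qed
  from this[of UNIV] have "det A \<le> det (H UNIV)" by simp
  also have "H UNIV = B" by (simp add: H_def vec_eq_iff)
  finally show ?thesis .
qed

theorem theorem5:
  fixes L U :: "real ^ 'n ^ 'n"
  assumes "L \<le> U"
    and "\<forall>A \<in> interval_matrix L U. M_matrix A"
  shows "det ` interval_matrix L U = {det L .. det U}"
proof (intro subset_antisym subsetI)
  fix d assume "d \<in> det ` interval_matrix L U"
  then obtain A where A: "L \<le> A" "A \<le> U" "d = det A" by (auto simp: interval_matrix_def)
  \<comment> \<open>Monotonicity is applied to the subintervals from \<open>L\<close> to
    \<open>A\<close> and from \<open>A\<close> to \<open>U\<close>, which inherit the M-matrix
    property.\<close>
  have "det L \<le> det A" "det A \<le> det U"
    using A assms by (auto intro!: det_mono_interval_M_matrix simp: interval_matrix_def)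
  with A show "d \<in> {det L..det U}" by simp
next
  fix d assume d: "d \<in> {det L..det U}"
  \<comment> \<open>The segment from \<open>L\<close> to \<open>U\<close> stays in the interval
    matrix, so a point where the determinant equals \<open>d\<close> is a preimage of the required
    kind.\<close>
  define F where "F t = L + t *\<^sub>R (U - L)" for t :: real
  have "continuous_on {0..1} (\<lambda>t. det (F t))"
    unfolding F_def by (intro continuous_intros)
  then obtain t where t: "0 \<le> t" "t \<le> 1" "det (F t) = d"
    using IVT'[of "\<lambda>t. det (F t)" 0 d 1] d by (auto simp: F_def)
  have "L $ i $ j \<le> F t $ i $ j \<and> F t $ i $ j \<le> U $ i $ j" for i j
    using \<open>L \<le> U\<close> t mult_left_le_one_le[of "U $ i $ j - L $ i $ j" t]
    by (simp add: F_def matrix_le_iff)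
  then have "F t \<in> interval_matrix L U"
    by (simp add: interval_matrix_def matrix_le_iff)
  with t show "d \<in> det ` interval_matrix L U" by auto
qed

end
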